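(* Let $G$ be an $n$-vertex graph with $n\ge 5$. If $G$ contains (as a subgraph) the square of an $n$-vertex tree, then $G$ is canceling. If $G$ contains the square of a Hamiltonian cycle (i.e. the square of an $n$-vertex cycle on $V(G)$), then $G$ is $2$-canceling.
   Context: All graphs are finite and simple. The square $H^2$ of a graph $H$ has vertex set $V(H)$, with $uv$ an edge iff $1\le d_H(u,v)\le 2$. A signing of $G$ is a function $\sigma:E(G)\to\{\pm1\}$. For a path $P$, $\sigma(P)=\sum_{e\in P}\sigma(e)$. The signed distance is $d_\sigma(u,v)=\min_P|\sigma(P)|$ over all $uv$-paths $P$ in $G$ (with $d_\sigma(u,v)=\infty$ if no such path exists, and $d_\sigma(u,u)=0$). The signed Wiener index is $W_\sigma(G)=\frac12\sum_{u,v\in V(G)}d_\sigma(u,v)$. For a subgraph or induced subgraph $G-S$ ($S\subseteq V(G)$, deleting the vertices of $S$), $\sigma$ is restricted to its edges and distances are computed within $G-S$. A signing $\sigma$ is $k$-canceling if $W_\sigma(G-S)=0$ for every $S\subseteq V(G)$ with $|S|<k$; $G$ is $k$-canceling if it has a $k$-canceling signing, and "canceling" means $1$-canceling (i.e. some signing has $W_\sigma(G)=0$). *)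

theory Defs
  imports Complex_Main "HOL-Library.Extended_Real"
begin

type_synonym 'a ugraph = "'a set \<times> 'a set set"

abbreviation verts :: "'a ugraph \<Rightarrow> 'a set" where "verts \<equiv> fst"

abbreviation edges :: "'a ugraph \<Rightarrow> 'a set set" where "edges \<equiv> snd"

definition simple_graph :: "'a ugraph \<Rightarrow> bool" where
  "simple_graph G \<longleftrightarrow> finite (verts G) \<and> (\<forall>e\<in>edges G. e \<subseteq> verts G \<and> card e = 2)"

definition subgraph :: "'a ugraph \<Rightarrow> 'a ugraph \<Rightarrow> bool" where
  "subgraph H G \<longleftrightarrow> verts H \<subseteq> verts G \<and> edges H \<subseteq> edges G"

definition del_verts :: "'a ugraph \<Rightarrow> 'a set \<Rightarrow> 'a ugraph" where
  "del_verts G S = (verts G - S, {e \<in> edges G. e \<inter> S = {}})"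

fun path_edges :: "'a list \<Rightarrow> 'a set list" where
  "path_edges (u # v # p) = {u, v} # path_edges (v # p)"
| "path_edges _ = []"

text \<open>A path is given by its non-empty list of pairwise distinct vertices.\<close>

definition paths :: "'a ugraph \<Rightarrow> 'a \<Rightarrow> 'a \<Rightarrow> 'a list set" where
  "paths G u v = {p. p \<noteq> [] \<and> hd p = u \<and> last p = v \<and> distinct p \<and>
     set p \<subseteq> verts G \<and> set (path_edges p) \<subseteq> edges G}"

text \<open>In \<^typ>\<open>enat\<close> the infimum of a non-empty set is attained, and the infimum of the
  empty set is \<open>\<infinity>\<close>.\<close>

definition gdist :: "'a ugraph \<Rightarrow> 'a \<Rightarrow> 'a \<Rightarrow> enat" where
  "gdist G u v = (INF p\<in>paths G u v. enat (length (path_edges p)))"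

definition square :: "'a ugraph \<Rightarrow> 'a ugraph" where
  "square H = (verts H,
     {{u, v} | u v. u \<in> verts H \<and> v \<in> verts H \<and> 1 \<le> gdist H u v \<and> gdist H u v \<le> 2})"

definition cycle_graph :: "'a ugraph \<Rightarrow> bool" where
  "cycle_graph C \<longleftrightarrow> (\<exists>vs. distinct vs \<and> length vs \<ge> 3 \<and>
     C = (set vs, insert {last vs, hd vs} (set (path_edges vs))))"

definition connected_graph :: "'a ugraph \<Rightarrow> bool" where
  "connected_graph G \<longleftrightarrow> verts G \<noteq> {} \<and> (\<forall>u\<in>verts G. \<forall>v\<in>verts G. paths G u v \<noteq> {})"

definition tree_graph :: "'a ugraph \<Rightarrow> bool" where
  "tree_graph T \<longleftrightarrow> simple_graph T \<and> connected_graph T \<and>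
     \<not> (\<exists>C. cycle_graph C \<and> subgraph C T)"

text \<open>Values of a signing outside the edge set are irrelevant, so that restricting a signing
  to a subgraph leaves the function unchanged.\<close>

definition signing :: "'a ugraph \<Rightarrow> ('a set \<Rightarrow> int) \<Rightarrow> bool" where
  "signing G \<sigma> \<longleftrightarrow> (\<forall>e\<in>edges G. \<sigma> e \<in> {1, -1})"

definition path_sign :: "('a set \<Rightarrow> int) \<Rightarrow> 'a list \<Rightarrow> int" where
  "path_sign \<sigma> p = (\<Sum>e\<leftarrow>path_edges p. \<sigma> e)"

definition signed_dist :: "'a ugraph \<Rightarrow> ('a set \<Rightarrow> int) \<Rightarrow> 'a \<Rightarrow> 'a \<Rightarrow> enat" where
  "signed_dist G \<sigma> u v = (INF p\<in>paths G u v. enat (nat \<bar>path_sign \<sigma> p\<bar>))"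

definition signed_wiener :: "'a ugraph \<Rightarrow> ('a set \<Rightarrow> int) \<Rightarrow> ereal" where
  "signed_wiener G \<sigma> =
     1 / 2 * (\<Sum>u\<in>verts G. \<Sum>v\<in>verts G. ereal_of_enat (signed_dist G \<sigma> u v))"

definition k_canceling_signing :: "nat \<Rightarrow> 'a ugraph \<Rightarrow> ('a set \<Rightarrow> int) \<Rightarrow> bool" where
  "k_canceling_signing k G \<sigma> \<longleftrightarrow> signing G \<sigma> \<and>
     (\<forall>S. S \<subseteq> verts G \<and> card S < k \<longrightarrow> signed_wiener (del_verts G S) \<sigma> = 0)"

definition k_canceling :: "nat \<Rightarrow> 'a ugraph \<Rightarrow> bool" where
  "k_canceling k G \<longleftrightarrow> (\<exists>\<sigma>. k_canceling_signing k G \<sigma>)"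

abbreviation canceling :: "'a ugraph \<Rightarrow> bool" where
  "canceling \<equiv> k_canceling 1"

end

theory Submission
  imports Defs
begin

text \<open>Give sign 1 to the edges of the tree \<open>T\<close> and sign -1 to the pairs at distance 2; the only
  property of \<open>T\<close> that matters is that it is connected and triangle-free. Two vertices joined in
  \<open>T\<close> by a path of \<open>d\<close> edges are joined by a path of sign 0 on the same vertices unless
  \<open>d \<in> {1, 2, 5}\<close>, and in these cases one or two vertices adjacent to the path repair the balance.
  For \<open>d = 5\<close> such a vertex is missing only if \<open>T\<close> is spanned by a path on 6 vertices, whose square
  gets an explicit signing.

  Deleting a vertex from a cycle leaves a path, so this argument applies to the square of an
  \<open>n\<close>-cycle unless \<open>n - 1\<close> is 4 or 6; the cases \<open>n = 5\<close> and \<open>n = 7\<close> are checked explicitly.\<close>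

section \<open>Paths of sign 0 and maps between graphs\<close>

text \<open>A signed distance is a minimum of absolute values, so one path of sign 0 settles it; the
  Wiener index vanishes as soon as every pair of vertices has such a path.\<close>

definition zero_path :: "'a ugraph \<Rightarrow> ('a set \<Rightarrow> int) \<Rightarrow> 'a \<Rightarrow> 'a \<Rightarrow> bool" where
  "zero_path G \<sigma> u v \<longleftrightarrow> (\<exists>p\<in>paths G u v. path_sign \<sigma> p = 0)"

lemma path_edges_append:
  "p \<noteq> [] \<Longrightarrow> q \<noteq> [] \<Longrightarrow> path_edges (p @ q) = path_edges p @ {last p, hd q} # path_edges q"
proof (induction p rule: path_edges.induct)
  case ("2_2" v)
  then show ?case by (cases q) auto
qed auto

lemma path_edges_rev: "path_edges (rev p) = rev (path_edges p)"
proof (induction p rule: path_edges.induct)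
  case (1 u v p)
  then show ?case
    using path_edges_append[of "rev (v # p)" "[u]"] by (simp add: insert_commute)
qed auto

lemma path_edges_map: "path_edges (map f p) = map ((`) f) (path_edges p)"
  by (induction p rule: path_edges.induct) auto

lemma Union_path_edges_subset: "\<Union> (set (path_edges p)) \<subseteq> set p"
  by (induction p rule: path_edges.induct) auto

lemma paths_rev: "p \<in> paths G u v \<Longrightarrow> rev p \<in> paths G v u"
  by (auto simp: paths_def path_edges_rev hd_rev last_rev)

lemma path_sign_rev: "path_sign \<sigma> (rev p) = path_sign \<sigma> p"
  by (simp add: path_sign_def path_edges_rev rev_map[symmetric] sum_list_rev)

lemma paths_Cons:
  assumes "p \<in> paths G x v" "{u, x} \<in> edges G" "u \<in> verts G" "u \<notin> set p"
  shows "u # p \<in> paths G u v" "path_sign \<sigma> (u # p) = \<sigma> {u, x} + path_sign \<sigma> p"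
  using assms by (cases p; auto simp: paths_def path_sign_def)+

lemma zero_path_refl: "u \<in> verts G \<Longrightarrow> zero_path G \<sigma> u u"
  unfolding zero_path_def by (rule bexI[of _ "[u]"]) (auto simp: paths_def path_sign_def)

lemma zero_path_sym: "zero_path G \<sigma> u v \<Longrightarrow> zero_path G \<sigma> v u"
  unfolding zero_path_def by (metis paths_rev path_sign_rev)

lemma zero_path_subgraph:
  "zero_path H \<sigma> u v \<Longrightarrow> subgraph H G \<Longrightarrow> zero_path G \<sigma> u v"
  unfolding zero_path_def paths_def subgraph_def by blast

text \<open>Injectivity keeps the vertices of a path distinct, and the sum is unchanged because
  signs agree edge by edge. This brings paths computed on natural numbers into
  \<open>G\<close>.\<close>

lemma zero_path_image:
  assumes "zero_path H \<tau> u v" "inj_on f (verts H)" "f ` verts H \<subseteq> verts G"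
    and "\<And>e. e \<in> edges H \<Longrightarrow> f ` e \<in> edges G \<and> \<sigma> (f ` e) = \<tau> e"
  shows "zero_path G \<sigma> (f u) (f v)"
proof -
  obtain p where p: "p \<in> paths H u v" "path_sign \<tau> p = 0"
    using assms(1) by (auto simp: zero_path_def)
  have "map f p \<in> paths G (f u) (f v)"
    using p(1) assms(2-4)
    by (auto simp: paths_def path_edges_map hd_map last_map distinct_map inj_on_subset)
  moreover have "map (\<lambda>e. \<sigma> (f ` e)) (path_edges p) = map \<tau> (path_edges p)"
    using p(1) assms(4) by (auto simp: paths_def)
  then have "path_sign \<sigma> (map f p) = 0"
    using p(2) unfolding path_sign_def path_edges_map map_map comp_def by presburger
  ultimately show ?thesis by (auto simp: zero_path_def)
qed

section \<open>From paths of sign 0 to canceling signings\<close>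

lemma signed_wiener_eq_0:
  assumes "\<And>u v. u \<in> verts G \<Longrightarrow> v \<in> verts G \<Longrightarrow> zero_path G \<sigma> u v"
  shows "signed_wiener G \<sigma> = 0"
proof -
  have "signed_dist G \<sigma> u v = 0" if uv: "u \<in> verts G" "v \<in> verts G" for u v
  proof -
    obtain p where p: "p \<in> paths G u v" "path_sign \<sigma> p = 0"
      using assms[OF uv] unfolding zero_path_def by blast
    have "signed_dist G \<sigma> u v \<le> enat (nat \<bar>path_sign \<sigma> p\<bar>)"
      unfolding signed_dist_def using p(1) by (rule INF_lower)
    then show ?thesis using p(2) by (simp add: zero_enat_def[symmetric])
  qed
  then show ?thesis by (simp add: signed_wiener_def)
qed

lemma del_verts_empty [simp]: "del_verts G {} = G"
  by (simp add: del_verts_def)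

lemma canceling_if_zero_paths:
  assumes "simple_graph G" "signing G \<sigma>"
    and "\<And>u v. u \<in> verts G \<Longrightarrow> v \<in> verts G \<Longrightarrow> zero_path G \<sigma> u v"
  shows "canceling G"
proof -
  have "S = {}" if "S \<subseteq> verts G" "card S < 1" for S
    using that assms(1) finite_subset by (fastforce simp: simple_graph_def)
  then show ?thesis
    unfolding k_canceling_def k_canceling_signing_def
    using assms(2) signed_wiener_eq_0[OF assms(3)] by (metis del_verts_empty)
qed

text \<open>Only the empty set and singletons are deleted, and the empty set reduces to a singleton:
  for given \<open>u\<close> and \<open>v\<close>, a path found after deleting a third vertex is
  also a path of \<open>G\<close>.\<close>

lemma two_canceling_if_zero_paths:
  assumes "simple_graph G" "signing G \<sigma>" "3 \<le> card (verts G)"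
    and zero: "\<And>w u v. w \<in> verts G \<Longrightarrow> u \<in> verts G - {w} \<Longrightarrow> v \<in> verts G - {w} \<Longrightarrow>
      zero_path (del_verts G {w}) \<sigma> u v"
  shows "k_canceling 2 G"
proof -
  have "signed_wiener (del_verts G S) \<sigma> = 0" if S: "S \<subseteq> verts G" "card S < 2" for S
  proof (rule signed_wiener_eq_0)
    fix u v assume uv: "u \<in> verts (del_verts G S)" "v \<in> verts (del_verts G S)"
    have "finite S" using S(1) assms(1) finite_subset by (auto simp: simple_graph_def)
    then consider "S = {}" | w where "S = {w}"
      using S(2) by (metis One_nat_def card_1_singletonE card_eq_0_iff less_2_cases)
    then show "zero_path (del_verts G S) \<sigma> u v"
    proof cases
      case 1
      have "card {u, v} < card (verts G)"
        using assms(3) card_length[of "[u, v]"] by simp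
      then obtain w where w: "w \<in> verts G" "w \<noteq> u" "w \<noteq> v"
        by (metis card_mono insertCI leD finite.intros subsetI insertE)
      then have "zero_path (del_verts G {w}) \<sigma> u v"
        using zero uv 1 by simp
      then show ?thesis
        using 1 by (auto elim!: zero_path_subgraph simp: subgraph_def del_verts_def)
    next
      case 2
      then show ?thesis using zero S(1) uv by (auto simp: del_verts_def)
    qed
  qed
  then show ?thesis
    unfolding k_canceling_def k_canceling_signing_def using assms(2) by blast
qed

section \<open>Edges of a square\<close>

lemma gdist_le_path: "p \<in> paths H u v \<Longrightarrow> gdist H u v \<le> enat (length (path_edges p))"
  unfolding gdist_def by (rule INF_lower)

lemma gdist_ge_1: "u \<noteq> v \<Longrightarrow> 1 \<le> gdist H u v"
  unfolding gdist_def
proof (rule INF_greatest)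
  fix p assume "u \<noteq> v" "p \<in> paths H u v"
  then show "1 \<le> enat (length (path_edges p))"
    by (cases p rule: path_edges.cases) (auto simp: paths_def one_enat_def)
qed

lemma simple_graph_edgeD:
  assumes "simple_graph G" "{x, y} \<in> edges G"
  shows "x \<noteq> y" "x \<in> verts G" "y \<in> verts G"
  using assms by (fastforce simp: simple_graph_def)+

lemma edge_in_square:
  assumes "simple_graph H" "{x, y} \<in> edges H"
  shows "{x, y} \<in> edges (square H)"
proof -
  note xy = simple_graph_edgeD[OF assms]
  have "[x, y] \<in> paths H x y" using xy assms by (auto simp: paths_def)
  from gdist_le_path[OF this] have "gdist H x y \<le> 1" by (simp add: one_enat_def)
  also have "\<dots> \<le> 2" by simp
  finally show ?thesis using xy gdist_ge_1[of x y H] by (auto simp: square_def)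
qed

lemma two_step_in_square:
  assumes "simple_graph H" "{x, c} \<in> edges H" "{c, y} \<in> edges H" "x \<noteq> y"
  shows "{x, y} \<in> edges (square H)"
proof -
  note xc = simple_graph_edgeD[OF assms(1,2)] and cy = simple_graph_edgeD[OF assms(1,3)]
  have "[x, c, y] \<in> paths H x y" using xc cy assms by (auto simp: paths_def)
  from gdist_le_path[OF this] have "gdist H x y \<le> 2" by (simp add: numeral_eq_enat numeral_2_eq_2)
  then show ?thesis using xc cy assms(4) gdist_ge_1[of x y H] by (auto simp: square_def)
qed

section \<open>Edges leaving a vertex set\<close>

lemma crossing_edge:
  "p \<noteq> [] \<Longrightarrow> hd p \<in> A \<Longrightarrow> last p \<notin> A \<Longrightarrow>
    \<exists>a b. {a, b} \<in> set (path_edges p) \<and> a \<in> A \<and> b \<notin> A"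
proof (induction p rule: path_edges.induct)
  case (1 u v p)
  then show ?case by (cases "v \<in> A") auto
qed auto

text \<open>A path from inside \<open>A\<close> to outside must leave \<open>A\<close> along some
  edge. Applied to the vertices collected so far, this supplies the extra vertices for the
  repairs.\<close>

lemma connected_graph_boundary:
  assumes "simple_graph T" "connected_graph T" "A \<subseteq> verts T" "A \<noteq> {}" "card A < card (verts T)"
  obtains a w where "a \<in> A" "w \<notin> A" "{a, w} \<in> edges T"
proof -
  obtain x y where "x \<in> A" "y \<in> verts T - A"
    using assms by (metis DiffI ex_in_conv less_irrefl subsetI subset_antisym)
  moreover from this obtain p where "p \<in> paths T x y"
    using assms(2,3) by (fastforce simp: connected_graph_def)
  ultimately show ?thesis
    using crossing_edge[of p A] that by (auto simp: paths_def)
qed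

section \<open>The signing by distance\<close>

text \<open>The two sign conditions agree only if \<open>T\<close> has no triangle. \<open>T\<close>
  and \<open>G\<close> are kept separate so that the same argument serves a tree inside its host
  graph and the path left after deleting a vertex from a cycle.\<close>

locale square_signing =
  fixes T G :: "'a ugraph" and \<sigma> :: "'a set \<Rightarrow> int"
  assumes simple: "simple_graph T"
    and verts_sub: "verts T \<subseteq> verts G"
    and pos_edge: "{x, y} \<in> edges T \<Longrightarrow> {x, y} \<in> edges G \<and> \<sigma> {x, y} = 1"
    and neg_edge: "{x, c} \<in> edges T \<Longrightarrow> {c, y} \<in> edges T \<Longrightarrow> x \<noteq> y \<Longrightarrow>
      {x, y} \<in> edges G \<and> \<sigma> {x, y} = -1"
begin

definition adj :: "'a \<Rightarrow> 'a \<Rightarrow> bool" where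
  "adj x y \<longleftrightarrow> {x, y} \<in> edges T"

text \<open>Carrying the sign as an argument reduces the balance of an explicit path to arithmetic
  on numerals.\<close>

definition step :: "'a \<Rightarrow> 'a \<Rightarrow> int \<Rightarrow> bool" where
  "step x y s \<longleftrightarrow> {x, y} \<in> edges G \<and> \<sigma> {x, y} = s \<and> x \<in> verts G \<and> y \<in> verts G"

lemma adj_sym: "adj x y \<Longrightarrow> adj y x"
  by (simp add: adj_def insert_commute)

lemma adj_neq: "adj x y \<Longrightarrow> x \<noteq> y"
  using simple_graph_edgeD[OF simple] by (simp add: adj_def)

lemma adj_verts: "adj x y \<Longrightarrow> x \<in> verts T \<and> y \<in> verts T"
  using simple_graph_edgeD[OF simple] by (simp add: adj_def)

lemma step_pos: "adj x y \<Longrightarrow> step x y 1"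
  using pos_edge adj_verts verts_sub by (auto simp: step_def adj_def)

lemma step_neg: "adj x c \<Longrightarrow> adj c y \<Longrightarrow> x \<noteq> y \<Longrightarrow> step x y (-1)"
  using neg_edge adj_verts[of x c] adj_verts[of c y] verts_sub
  by (auto simp: step_def adj_def)

text \<open>A sum of an odd number of signs is odd, so paths of sign 0 have even length; lengths 2,
  4 and 6 suffice for the repairs.\<close>

lemma zero_path2:
  assumes "step a b s" "step b c t" "a \<noteq> b" "b \<noteq> c" "a \<noteq> c" "s + t = 0"
  shows "zero_path G \<sigma> a c"
  unfolding zero_path_def using assms
  by (intro bexI[of _ "[a, b, c]"]) (auto simp: paths_def path_sign_def step_def)

lemma zero_path4:
  assumes "step a b s" "step b c t" "step c d q" "step d e r" "distinct [a, b, c, d, e]"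
    "s + t + q + r = 0"
  shows "zero_path G \<sigma> a e"
  unfolding zero_path_def using assms
  by (intro bexI[of _ "[a, b, c, d, e]"]) (auto simp: paths_def path_sign_def step_def)

lemma zero_path6:
  assumes "step a b s" "step b c t" "step c d q" "step d e r" "step e f k" "step f g l"
    "distinct [a, b, c, d, e, f, g]" "s + t + q + r + k + l = 0"
  shows "zero_path G \<sigma> a g"
  unfolding zero_path_def using assms
  by (intro bexI[of _ "[a, b, c, d, e, f, g]"]) (auto simp: paths_def path_sign_def step_def)

text \<open>Traversing \<open>x\<^sub>0 x\<^sub>1 x\<^sub>3\<close> advances by three, and \<open>x\<^sub>0 x\<^sub>2 x\<^sub>1 x\<^sub>3 x\<^sub>4\<close> by four; both have sign 0.
  Hence a path of \<open>d\<close> edges can be traversed with sign 0 when \<open>d = 3b + 4c\<close>, i.e. \<open>d \<notin> {1, 2, 5}\<close>.\<close>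

lemma zero_path_along_path:
  assumes "p \<in> paths T u v" "length p \<notin> {2, 3, 6}"
  shows "\<exists>q\<in>paths G u v. path_sign \<sigma> q = 0 \<and> set q \<subseteq> set p"
  using assms
proof (induction "length p" arbitrary: p u rule: less_induct)
  case less
  have "length p \<noteq> 0" using less.prems(1) by (simp add: paths_def)
  moreover have "length p \<noteq> 2" "length p \<noteq> 3" using less.prems(2) by auto
  ultimately have "length p = 1 \<or> length p \<ge> 4" by linarith
  \<comment> \<open>Lengths count vertices, one more than edges. Removing a block of three edges
    leaves \<open>length p - 3\<close>, which must avoid 2, 3 and 6; so 5 and 9 are treated
    directly, by one and two blocks of four edges.\<close>
  then consider "length p = 1" | "length p = 5" | "length p = 9"
    | "length p \<ge> 4" "length p \<notin> {5, 6, 9}"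
    using less.prems(2) by auto
  then show ?case
  proof cases
    case 1
    then show ?thesis
      using less.prems(1) verts_sub
      by (intro bexI[of _ p]) (auto simp: length_Suc_conv paths_def path_sign_def)
  next
    case 2
    then obtain a b c d e where p: "p = [a, b, c, d, e]"
      by (auto simp: numeral_eq_Suc length_Suc_conv)
    have uv: "u = a" "v = e" and dist: "distinct p" and
      adjs: "adj a b" "adj b c" "adj c d" "adj d e"
      using less.prems(1) by (auto simp: p paths_def adj_def)
    have "step a c (-1)" "step c b 1" "step b d (-1)" "step d e 1"
      using adjs dist by (auto simp: p intro: step_pos step_neg adj_sym)
    then show ?thesis
      using dist by (intro bexI[of _ "[a, c, b, d, e]"])
        (auto simp: p uv paths_def path_sign_def step_def)
  next
    case 3
    then obtain a b c d e f g h i where p: "p = [a, b, c, d, e, f, g, h, i]"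
      by (auto simp: numeral_eq_Suc length_Suc_conv)
    have uv: "u = a" "v = i" and dist: "distinct p" and
      adjs: "adj a b" "adj b c" "adj c d" "adj d e" "adj e f" "adj f g" "adj g h" "adj h i"
      using less.prems(1) by (auto simp: p paths_def adj_def)
    have "step a c (-1)" "step c b 1" "step b d (-1)" "step d e 1"
      "step e g (-1)" "step g f 1" "step f h (-1)" "step h i 1"
      using adjs dist by (auto simp: p intro: step_pos step_neg adj_sym)
    then show ?thesis
      using dist by (intro bexI[of _ "[a, c, b, d, e, g, f, h, i]"])
        (auto simp: p uv paths_def path_sign_def step_def)
  next
    case 4
    then obtain a b c d r where p: "p = a # b # c # d # r"
      by (auto simp: numeral_eq_Suc Suc_le_length_iff)
    have uv: "u = a" and dist: "distinct p" and adjs: "adj a b" "adj b c" "adj c d"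
      and r: "d # r \<in> paths T d v"
      using less.prems(1) by (auto simp: p paths_def adj_def)
    have "length (d # r) \<notin> {2, 3, 6}" using 4 by (auto simp: p)
    with less.hyps[of "d # r" d] r obtain q where
      q: "q \<in> paths G d v" "path_sign \<sigma> q = 0" "set q \<subseteq> set (d # r)"
      by (auto simp: p)
    have ab: "step a b 1" and bd: "step b d (-1)"
      using adjs dist by (auto simp: p intro: step_pos step_neg)
    \<comment> \<open>The containment of vertex sets in the conclusion serves here: the path from
      \<open>d\<close> may reorder the vertices of \<open>d # r\<close> but cannot return to
      \<open>a\<close> or \<open>b\<close>.\<close>
    have notin: "b \<notin> set q" "a \<notin> set (b # q)" using q(3) dist by (auto simp: p)
    note bq = paths_Cons[OF q(1), of b] and abq = paths_Cons[of "b # q" G b v a]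
    have "a # b # q \<in> paths G u v" "path_sign \<sigma> (a # b # q) = 0"
      using ab bd notin q(2) bq abq by (auto simp: step_def uv)
    moreover have "set (a # b # q) \<subseteq> set p" using q(3) by (auto simp: p)
    ultimately show ?thesis by blast
  qed
qed

text \<open>Any path of \<open>T\<close> from \<open>u\<close> to \<open>v\<close> will do unless it
  has 1, 2 or 5 edges. These cases borrow one, two and one further vertices, available because
  \<open>T\<close> is connected, has at least five vertices, and by \<open>no6\<close> is not
  spanned by a path on six vertices.\<close>

lemma zero_path_all:
  assumes conn: "connected_graph T" and card5: "5 \<le> card (verts T)"
    and no6: "\<And>u v p. p \<in> paths T u v \<Longrightarrow> length p = 6 \<Longrightarrow> card (verts T) \<noteq> 6"
    and uv: "u \<in> verts T" "v \<in> verts T"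
  shows "zero_path G \<sigma> u v"
proof -
  have fin: "finite (verts T)" using simple by (simp add: simple_graph_def)
  have boundary: "\<exists>a\<in>set A. \<exists>w. w \<notin> set A \<and> adj a w"
    if "set A \<subseteq> verts T" "A \<noteq> []" "length A < card (verts T)" for A
  proof -
    have "card (set A) < card (verts T)" using that(3) card_length[of A] by simp
    then show ?thesis
      using connected_graph_boundary[OF simple conn that(1)] that(2) by (metis adj_def set_empty)
  qed
  obtain p where p: "p \<in> paths T u v"
    using conn uv by (auto simp: connected_graph_def)
  then have distp: "distinct p" by (simp add: paths_def)
  consider "length p = 2" | "length p = 3" | "length p = 6" | "length p \<notin> {2, 3, 6}"
    by auto
  then show ?thesis
  proof cases
    case 1
    then have p_eq: "p = [u, v]" using p by (auto simp: numeral_eq_Suc length_Suc_conv paths_def)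
    have uv': "adj u v" "adj v u" using p adj_sym by (auto simp: p_eq paths_def adj_def)
    obtain a w where w: "a \<in> set [u, v]" "w \<notin> set [u, v]" "adj a w"
      using boundary[of "[u, v]"] uv card5 by auto
    \<comment> \<open>The detour through \<open>w\<close> uses one edge of \<open>T\<close> and one
      pair with a common neighbour, namely the end of the edge to which \<open>w\<close> is
      attached.\<close>
    consider "adj u w" | "adj v w" using w by auto
    then show ?thesis
    proof cases
      case 1
      then show ?thesis using uv' w
        by (intro zero_path2[of u w 1 v "-1"]) (auto intro: step_pos step_neg adj_sym dest: adj_neq)
    next
      case 2
      then show ?thesis using uv' w
        by (intro zero_path2[of u w "-1" v 1]) (auto intro: step_pos step_neg adj_sym dest: adj_neq)
    qed
  next
    case 2
    then obtain c where p_eq: "p = [u, c, v]"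
      using p by (auto simp: numeral_eq_Suc length_Suc_conv paths_def)
    have c: "c \<in> verts T" using p by (auto simp: p_eq paths_def)
    have A: "adj u c" "adj c u" "adj c v" "adj v c"
      using p adj_sym by (auto simp: p_eq paths_def adj_def)
    obtain a1 w1 where w1: "a1 \<in> set p" "w1 \<notin> set p" "adj a1 w1"
      using boundary[of p] uv c card5 by (auto simp: p_eq)
    obtain a2 w2 where w2: "a2 \<in> set (w1 # p)" "w2 \<notin> set (w1 # p)" "adj a2 w2"
      using boundary[of "w1 # p"] uv c card5 adj_verts[OF w1(3)] by (auto simp: p_eq)
    note W = w1(3) w2(3) adj_sym[OF w1(3)] adj_sym[OF w2(3)]
    have D: "distinct [u, c, v, w1, w2]" using distp w1(2) w2(2) by (auto simp: p_eq)
    \<comment> \<open>The vertex \<open>w1\<close> has three possible attachments and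
      \<open>w2\<close> four. In each of the twelve shapes the chosen path visits all five vertices,
      with two steps of each sign.\<close>
    have "a1 = u \<or> a1 = c \<or> a1 = v" "a2 = u \<or> a2 = c \<or> a2 = v \<or> a2 = w1"
      using w1(1) w2(1) by (auto simp: p_eq)
    then consider
        "a1 = c" "a2 = c" | "a1 = c" "a2 = w1" | "a1 = c" "a2 = u" | "a1 = c" "a2 = v"
      | "a1 = u" "a2 = u" | "a1 = u" "a2 = w1" | "a1 = u" "a2 = v" | "a1 = u" "a2 = c"
      | "a1 = v" "a2 = v" | "a1 = v" "a2 = w1" | "a1 = v" "a2 = u" | "a1 = v" "a2 = c"
      by blast
    then show ?thesis
    proof cases
      case 1
      show ?thesis using A W[unfolded 1] D
        by (intro zero_path4[of u c 1 w1 1 w2 "-1" v "-1"]) (auto intro: step_pos step_neg)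
    next
      case 2
      show ?thesis using A W[unfolded 2] D
        by (intro zero_path4[of u w1 "-1" w2 1 c "-1" v 1]) (auto intro: step_pos step_neg)
    next
      case 3
      show ?thesis using A W[unfolded 3] D
        by (intro zero_path4[of u w2 1 c "-1" w1 1 v "-1"]) (auto intro: step_pos step_neg)
    next
      case 4
      show ?thesis using A W[unfolded 4] D
        by (intro zero_path4[of u w1 "-1" c 1 w2 "-1" v 1]) (auto intro: step_pos step_neg)
    next
      case 5
      show ?thesis using A W[unfolded 5] D
        by (intro zero_path4[of u w1 1 w2 "-1" c "-1" v 1]) (auto intro: step_pos step_neg)
    next
      case 6
      show ?thesis using A W[unfolded 6] D
        by (intro zero_path4[of u w2 "-1" w1 1 c "-1" v 1]) (auto intro: step_pos step_neg)
    next
      case 7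
      show ?thesis using A W[unfolded 7] D
        by (intro zero_path4[of u w1 1 c "-1" w2 "-1" v 1]) (auto intro: step_pos step_neg)
    next
      case 8
      show ?thesis using A W[unfolded 8] D
        by (intro zero_path4[of u w1 1 c "-1" w2 1 v "-1"]) (auto intro: step_pos step_neg)
    next
      case 9
      show ?thesis using A W[unfolded 9] D
        by (intro zero_path4[of u c 1 w1 "-1" w2 "-1" v 1]) (auto intro: step_pos step_neg)
    next
      case 10
      show ?thesis using A W[unfolded 10] D
        by (intro zero_path4[of u c 1 w1 "-1" w2 1 v "-1"]) (auto intro: step_pos step_neg)
    next
      case 11
      show ?thesis using A W[unfolded 11] D
        by (intro zero_path4[of u w2 1 c "-1" w1 "-1" v 1]) (auto intro: step_pos step_neg)
    next
      case 12
      show ?thesis using A W[unfolded 12] D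
        by (intro zero_path4[of u w2 "-1" c 1 w1 "-1" v 1]) (auto intro: step_pos step_neg)
    qed
  next
    case 3
    then obtain x1 x2 x3 x4 where p_eq: "p = [u, x1, x2, x3, x4, v]"
      using p by (auto simp: numeral_eq_Suc length_Suc_conv paths_def)
    have A: "adj u x1" "adj x1 x2" "adj x2 x3" "adj x3 x4" "adj x4 v"
      using p by (auto simp: p_eq paths_def adj_def)
    note B = A[THEN adj_sym]
    have "set p \<subseteq> verts T" using p by (auto simp: paths_def)
    \<comment> \<open>The path has six vertices and \<open>no6\<close> excludes that these are all,
      so a seventh vertex is attached somewhere.\<close>
    moreover have "length p < card (verts T)"
      using no6[OF p 3] card_mono[OF fin \<open>set p \<subseteq> verts T\<close>] distinct_card[OF distp] 3 by simp
    ultimately obtain a w where w: "a \<in> set p" "w \<notin> set p" "adj a w"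
      using boundary[of p] by (auto simp: p_eq)
    note W = w(3) adj_sym[OF w(3)]
    have D: "distinct [u, x1, x2, x3, x4, v, w]" using distp w(2) by (auto simp: p_eq)
    \<comment> \<open>Wherever \<open>w\<close> is attached, the chosen path visits all seven
      vertices, with three steps of each sign.\<close>
    consider "a = u" | "a = x1" | "a = x2" | "a = x3" | "a = x4" | "a = v"
      using w(1) by (auto simp: p_eq)
    then show ?thesis
    proof cases
      case 1
      show ?thesis using A B W[unfolded 1] D
        by (intro zero_path6[of u w 1 x1 "-1" x3 "-1" x2 1 x4 "-1" v 1])
          (auto intro: step_pos step_neg)
    next
      case 2
      show ?thesis using A B W[unfolded 2] D
        by (intro zero_path6[of u w "-1" x1 1 x3 "-1" x2 1 x4 "-1" v 1])
          (auto intro: step_pos step_neg)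
    next
      case 3
      show ?thesis using A B W[unfolded 3] D
        by (intro zero_path6[of u x1 1 w "-1" x2 1 x4 "-1" x3 1 v "-1"])
          (auto intro: step_pos step_neg)
    next
      case 4
      show ?thesis using A B W[unfolded 4] D
        by (intro zero_path6[of u x2 "-1" x1 1 x3 "-1" w 1 x4 "-1" v 1])
          (auto intro: step_pos step_neg)
    next
      case 5
      show ?thesis using A B W[unfolded 5] D
        by (intro zero_path6[of u x2 "-1" x1 1 x3 "-1" x4 1 w 1 v "-1"])
          (auto intro: step_pos step_neg)
    next
      case 6
      show ?thesis using A B W[unfolded 6] D
        by (intro zero_path6[of u x2 "-1" x1 1 x3 "-1" x4 1 w "-1" v 1])
          (auto intro: step_pos step_neg)
    qed
  next
    case 4
    then show ?thesis
      using zero_path_along_path[OF p] by (auto simp: zero_path_def)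
  qed
qed

end

section \<open>Paths and cycles as vertex lists\<close>

lemma set_path_edges: "set (path_edges p) = (\<lambda>i. {p ! i, p ! Suc i}) ` {i. Suc i < length p}"
proof (induction p rule: path_edges.induct)
  case (1 u v p)
  have "{i. Suc i < length (u # v # p)} = insert 0 (Suc ` {i. Suc i < length (v # p)})"
    by (auto simp: image_iff less_Suc_eq_0_disj)
  with 1 show ?case by (simp add: image_image)
qed auto

text \<open>The segment of \<open>p\<close> between two positions joins their vertices; reversal
  covers the opposite order.\<close>

lemma connected_path_graph:
  assumes "distinct p" "p \<noteq> []"
  shows "connected_graph (set p, set (path_edges p))"
proof -
  let ?G = "(set p, set (path_edges p))"
  have aux: "paths ?G (p ! i) (p ! j) \<noteq> {}" if "i \<le> j" "j < length p" for i j
  proof -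
    \<comment> \<open>\<open>Suc j\<close> makes the segment include position
      \<open>j\<close>.\<close>
    let ?q = "drop i (take (Suc j) p)"
    have len: "length ?q = Suc j - i" using that by simp
    then have ne: "?q \<noteq> []" using that by (metis Suc_diff_le length_0_conv nat.distinct(1))
    have "set (path_edges ?q) \<subseteq> set (path_edges p)"
      unfolding set_path_edges using that by (fastforce simp: image_iff)
    moreover have "hd ?q = p ! i" using that ne by (simp add: hd_drop_conv_nth)
    moreover have "last ?q = p ! j" using that ne by (simp add: last_conv_nth)
    moreover have "set ?q \<subseteq> set p" by (meson order_trans set_drop_subset set_take_subset)
    ultimately have "?q \<in> paths ?G (p ! i) (p ! j)"
      using assms ne unfolding paths_def by (auto simp del: drop_eq_Nil)
    then show ?thesis by blast
  qed
  have "paths ?G (p ! i) (p ! j) \<noteq> {}" if "i < length p" "j < length p" for i j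
    using aux[of i j] aux[of j i] that paths_rev[of _ ?G "p ! j" "p ! i"]
    by (cases "i \<le> j") (auto simp: not_le dest: less_imp_le)
  then show ?thesis
    using assms(2) by (auto simp: connected_graph_def in_set_conv_nth)
qed

lemma cycle_edges_nth:
  assumes "vs \<noteq> []"
  shows "insert {last vs, hd vs} (set (path_edges vs)) =
    (\<lambda>i. {vs ! i, vs ! (Suc i mod length vs)}) ` {..<length vs}"
proof -
  have "{..<length vs} = insert (length vs - 1) {i. Suc i < length vs}"
    using assms by (auto simp: neq_Nil_conv)
  moreover have "Suc (length vs - 1) = length vs" using assms by simp
  ultimately show ?thesis
    using assms by (auto simp: set_path_edges last_conv_nth hd_conv_nth)
qed

text \<open>Length at least 4 excludes the triangle, so pairs with a common neighbour are never
  edges of \<open>C\<close>.\<close>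

locale cycle_list =
  fixes vs :: "'a list" and C :: "'a ugraph"
  assumes dist: "distinct vs" and len: "4 \<le> length vs"
    and C_eq: "C = (set vs, insert {last vs, hd vs} (set (path_edges vs)))"
begin

lemma cycle_edges: "edges C = (\<lambda>i. {vs ! i, vs ! (Suc i mod length vs)}) ` {..<length vs}"
proof -
  have "vs \<noteq> []" using len by auto
  then show ?thesis using cycle_edges_nth by (simp add: C_eq)
qed

lemma adjacent_nth_iff:
  assumes "i < length vs" "j < length vs"
  shows "{vs ! i, vs ! j} \<in> edges C \<longleftrightarrow> j = Suc i mod length vs \<or> i = Suc j mod length vs"
proof -
  have "Suc k mod length vs < length vs" for k using len by (intro mod_less_divisor) linarith
  then show ?thesis
    using assms dist
    by (auto simp: cycle_edges image_iff doubleton_eq_iff nth_eq_iff_index_eq)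
qed

lemma simple_cycle: "simple_graph C"
proof -
  have "Suc i mod length vs \<noteq> i \<and> Suc i mod length vs < length vs" if "i < length vs" for i
    using that len by (auto simp: mod_Suc)
  then have "e \<subseteq> verts C \<and> card e = 2" if "e \<in> edges C" for e
    using that dist unfolding cycle_edges by (auto simp: C_eq nth_eq_iff_index_eq card_2_iff')
  then show ?thesis by (simp add: simple_graph_def C_eq)
qed

text \<open>Since \<open>x\<close> and \<open>y\<close> differ, their positions are two apart around
  the cycle; being also one apart would force the length to divide 1 or 3.\<close>

lemma triangle_free:
  assumes "{x, c} \<in> edges C" "{c, y} \<in> edges C" "x \<noteq> y"
  shows "{x, y} \<notin> edges C"
proof -
  have "x \<in> set vs" "c \<in> set vs" "y \<in> set vs"
    using simple_graph_edgeD[OF simple_cycle assms(1)] simple_graph_edgeD[OF simple_cycle assms(2)]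
    by (auto simp: C_eq)
  then obtain i k j where "x = vs ! i" "c = vs ! k" "y = vs ! j"
    and ikj: "i < length vs" "k < length vs" "j < length vs"
    by (auto simp: in_set_conv_nth)
  with assms show ?thesis
    using len by (auto simp: adjacent_nth_iff[OF ikj(1,2)] adjacent_nth_iff[OF ikj(2,3)]
        adjacent_nth_iff[OF ikj(1,3)] mod_Suc split: if_splits)
qed

text \<open>Rotate the cycle to start just after \<open>w\<close>: with
  \<open>vs = as @ w # bs\<close>, the list \<open>bs @ as\<close> has the closing edge of the cycle
  as its joint.\<close>

lemma deleted_vertex_path:
  assumes "w \<in> set vs"
  obtains ys where "distinct ys" "set ys = set vs - {w}" "set (path_edges ys) \<subseteq> edges C"
proof -
  obtain as bs where vs: "vs = as @ w # bs" using assms by (meson split_list)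
  have "set (path_edges (bs @ as)) \<subseteq> edges C"
  \<comment> \<open>With \<open>as\<close> or \<open>bs\<close> empty there is no joint, because the
    closing edge meets \<open>w\<close>.\<close>
  proof (cases "as = [] \<or> bs = []")
    case True
    then show ?thesis
      using path_edges_append[of "[w]" bs] path_edges_append[of as "[w]"] len
      by (cases "as = []"; cases "bs = []") (auto simp: C_eq vs)
  next
    case False
    then show ?thesis
      using path_edges_append[of bs as] path_edges_append[of as "w # bs"]
        path_edges_append[of "[w]" bs]
      by (auto simp: C_eq vs)
  qed
  then show ?thesis using dist that[of "bs @ as"] by (auto simp: vs)
qed

end

section \<open>Finite certificates for explicit signings\<close>

definition listed_sign :: "'a set list \<Rightarrow> 'a set \<Rightarrow> int" where
  "listed_sign P e = (if e \<in> set P then 1 else -1)"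

text \<open>Edges and paths are lists over an initial segment of the naturals, so that
  \<open>code_simp\<close> can evaluate the check. \<open>E\<close> lists the edges available and
  \<open>P\<close> the positive ones; which pairs the paths join is a separate condition.\<close>

definition certificate :: "nat \<Rightarrow> nat set list \<Rightarrow> nat set list \<Rightarrow> nat list list \<Rightarrow> bool" where
  "certificate n E P ps \<longleftrightarrow> (\<forall>p\<in>set ps. p \<noteq> [] \<and> distinct p \<and> set p \<subseteq> set [0..<n] \<and>
     set (path_edges p) \<subseteq> set E \<and> (\<Sum>e\<leftarrow>path_edges p. listed_sign P e) = 0)"

lemma zero_path_certificate:
  assumes "certificate n E P ps" "p \<in> set ps" "set p \<inter> S = {}"
  shows "zero_path (del_verts ({..<n}, set E) S) (listed_sign P) (hd p) (last p)"
  using assms Union_path_edges_subset[of p]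
  by (fastforce simp: certificate_def zero_path_def paths_def del_verts_def path_sign_def)

text \<open>An edge is pulled back to the positions of its ends in \<open>vs\<close>. Edges of
  \<open>G\<close> outside the copied square receive a sign too, so the result is a signing of all
  of \<open>G\<close>.\<close>

definition transport_sign :: "'a list \<Rightarrow> (nat set \<Rightarrow> int) \<Rightarrow> 'a set \<Rightarrow> int" where
  "transport_sign vs \<tau> e = \<tau> {i. i < length vs \<and> vs ! i \<in> e}"

text \<open>Indexing into a distinct list is injective, so pulling an image edge back recovers the
  original edge, and an edge avoids \<open>S\<close> exactly when its image avoids the image of
  \<open>S\<close>.\<close>

lemma zero_path_transport:
  assumes vs: "distinct vs" "set vs \<subseteq> verts G"
    and E: "\<And>e. e \<in> set E \<Longrightarrow> e \<subseteq> {..<length vs} \<and> (!) vs ` e \<in> edges G"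
    and S: "S \<subseteq> {..<length vs}"
    and zero: "zero_path (del_verts ({..<length vs}, set E) S) \<tau> u v"
  shows "zero_path (del_verts G ((!) vs ` S)) (transport_sign vs \<tau>) (vs ! u) (vs ! v)"
proof (rule zero_path_image[OF zero])
  have inj: "inj_on ((!) vs) {..<length vs}" using vs(1) by (simp add: inj_on_nth)
  then show "inj_on ((!) vs) (verts (del_verts ({..<length vs}, set E) S))"
    by (rule inj_on_subset) (simp add: del_verts_def)
  show "(!) vs ` verts (del_verts ({..<length vs}, set E) S) \<subseteq> verts (del_verts G ((!) vs ` S))"
    using vs S inj by (auto simp: del_verts_def nth_eq_iff_index_eq subset_eq)
  fix e assume "e \<in> edges (del_verts ({..<length vs}, set E) S)"
  then have e: "e \<in> set E" "e \<inter> S = {}" "e \<subseteq> {..<length vs}"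
    using E by (auto simp: del_verts_def)
  have "(!) vs ` e \<inter> (!) vs ` S = (!) vs ` (e \<inter> S)"
    using inj_on_image_Int[OF inj e(3) S] by simp
  moreover have "{i. i < length vs \<and> vs ! i \<in> (!) vs ` e} = e"
    using e(3) vs(1) by (auto simp: nth_eq_iff_index_eq subset_eq)
  ultimately show "(!) vs ` e \<in> edges (del_verts G ((!) vs ` S)) \<and>
      transport_sign vs \<tau> ((!) vs ` e) = \<tau> e"
    using e E by (simp add: del_verts_def transport_sign_def)
qed

lemma signing_transport: "signing G (transport_sign vs (listed_sign P))"
  by (simp add: signing_def transport_sign_def listed_sign_def)

definition path_square :: "nat \<Rightarrow> nat set list" where
  "path_square n = map (\<lambda>i. {i, Suc i}) [0..<n - 1] @ map (\<lambda>i. {i, Suc (Suc i)}) [0..<n - 2]"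

definition cycle_square :: "nat \<Rightarrow> nat set list" where
  "cycle_square n = map (\<lambda>i. {i, Suc i mod n}) [0..<n] @ map (\<lambda>i. {i, Suc (Suc i) mod n}) [0..<n]"

lemma canceling_certificate:
  assumes G: "simple_graph G" and vs: "distinct vs" "set vs = verts G"
    and E: "\<And>e. e \<in> set E \<Longrightarrow> e \<subseteq> {..<length vs} \<and> (!) vs ` e \<in> edges G"
    and cert: "certificate (length vs) E P ps"
    and cover: "\<forall>u\<in>set [0..<length vs]. \<forall>v\<in>set [0..<length vs]. u \<noteq> v \<longrightarrow>
      (\<exists>p\<in>set ps. hd p = u \<and> last p = v \<or> hd p = v \<and> last p = u)"
  shows "canceling G"
proof (rule canceling_if_zero_paths[OF G signing_transport])
  fix x y assume xy: "x \<in> verts G" "y \<in> verts G"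
  show "zero_path G (transport_sign vs (listed_sign P)) x y"
  proof (cases "x = y")
    case True
    then show ?thesis using xy zero_path_refl by metis
  next
    case False
    obtain u v where u: "u < length vs" "x = vs ! u" and v: "v < length vs" "y = vs ! v"
      using xy by (metis vs(2) in_set_conv_nth)
    then obtain p where p: "p \<in> set ps" "hd p = u \<and> last p = v \<or> hd p = v \<and> last p = u"
      using cover False by (metis atLeastLessThan_iff le0 set_upt)
    have "zero_path (del_verts ({..<length vs}, set E) {}) (listed_sign P) u v"
      using zero_path_certificate[OF cert p(1) Int_empty_right] p(2) by (metis zero_path_sym)
    from zero_path_transport[OF vs(1) _ E _ this] vs(2) show ?thesis
      by (simp add: u(2) v(2))
  qed
qed

text \<open>One signing must survive every deletion, so for each pair and each deleted
  \<open>w\<close> some listed path has to avoid \<open>w\<close>; a pair may thus need several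
  paths.\<close>

lemma two_canceling_certificate:
  assumes G: "simple_graph G" "3 \<le> card (verts G)" and vs: "distinct vs" "set vs = verts G"
    and E: "\<And>e. e \<in> set E \<Longrightarrow> e \<subseteq> {..<length vs} \<and> (!) vs ` e \<in> edges G"
    and cert: "certificate (length vs) E P ps"
    and cover: "\<forall>u\<in>set [0..<length vs]. \<forall>v\<in>set [0..<length vs]. \<forall>w\<in>set [0..<length vs].
      u \<noteq> v \<and> u \<noteq> w \<and> v \<noteq> w \<longrightarrow>
      (\<exists>p\<in>set ps. (hd p = u \<and> last p = v \<or> hd p = v \<and> last p = u) \<and> w \<notin> set p)"
  shows "k_canceling 2 G"
proof (rule two_canceling_if_zero_paths[OF G(1) signing_transport G(2)])
  fix z x y assume z: "z \<in> verts G" and xy: "x \<in> verts G - {z}" "y \<in> verts G - {z}"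
  show "zero_path (del_verts G {z}) (transport_sign vs (listed_sign P)) x y"
  proof (cases "x = y")
    case True
    then show ?thesis using xy zero_path_refl[of x "del_verts G {z}"] by (simp add: del_verts_def)
  next
    case False
    obtain u v w where u: "u < length vs" "x = vs ! u" and v: "v < length vs" "y = vs ! v"
      and w: "w < length vs" "z = vs ! w"
      using xy z by (metis vs(2) in_set_conv_nth Diff_iff)
    have "u \<noteq> v \<and> u \<noteq> w \<and> v \<noteq> w" using False xy u v w by auto
    moreover have "u \<in> set [0..<length vs]" "v \<in> set [0..<length vs]" "w \<in> set [0..<length vs]"
      using u v w by simp_all
    ultimately obtain p where p: "p \<in> set ps"
      "hd p = u \<and> last p = v \<or> hd p = v \<and> last p = u" "w \<notin> set p"
      using cover by blast
    have *: "set p \<inter> {w} = {}" using p(3) by simp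
    have "zero_path (del_verts ({..<length vs}, set E) {w}) (listed_sign P) u v"
      using zero_path_certificate[OF cert p(1) *] p(2) by (metis zero_path_sym)
    from zero_path_transport[OF vs(1) _ E _ this] vs(2) w(1) show ?thesis
      by (simp add: u(2) v(2) w(2))
  qed
qed

text \<open>On a path of six vertices signed by distance, a path of sign 0 with \<open>k\<close>
  edges of each sign advances by a number of the same parity as \<open>k\<close>. Advancing by 5
  needs \<open>k\<close> odd, but \<open>k = 1\<close> reaches at most 3 and \<open>k = 3\<close>
  needs seven vertices. Hence a different signing.\<close>

lemma canceling_path6_square:
  assumes G: "simple_graph G" and T: "simple_graph T" "edges (square T) \<subseteq> edges G"
    and p: "p \<in> paths T u v" "length p = 6" "set p = verts G"
  shows "canceling G"
proof (rule canceling_certificate[OF G, of p])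
  show "distinct p" "set p = verts G" using p by (auto simp: paths_def)
  have step: "{p ! i, p ! Suc i} \<in> edges T" if "Suc i < 6" for i
    using p(1,2) that by (auto simp: paths_def set_path_edges)
  have "{p ! i, p ! Suc (Suc i)} \<in> edges (square T)" if "Suc (Suc i) < 6" for i
    using two_step_in_square[OF T(1) step step, of i] that p(2) \<open>distinct p\<close>
    by (simp add: nth_eq_iff_index_eq)
  then show "e \<subseteq> {..<length p} \<and> (!) p ` e \<in> edges G" if "e \<in> set (path_square 6)" for e
    using that T(2) edge_in_square[OF T(1) step] by (auto simp: path_square_def p(2))
  \<comment> \<open>First the three positive edges, then one path for each of the 15 pairs.\<close>
  show "certificate (length p) (path_square 6) [{0, 1}, {1, 3}, {2, 4}]
     [[0, 2, 4, 3, 1], [0, 1, 2], [0, 1, 2, 4, 3], [0, 1, 3, 5, 4], [0, 1, 2, 4, 5],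
      [1, 0, 2], [1, 0, 2, 4, 3], [1, 2, 4], [1, 0, 2, 4, 5], [2, 1, 3], [2, 0, 1, 3, 4],
      [2, 0, 1, 3, 5], [3, 2, 4], [3, 1, 2, 4, 5], [4, 2, 1, 3, 5]]"
    unfolding p(2) by code_simp
qed (unfold p(2), code_simp)

section \<open>Squares of cycles\<close>

context cycle_list
begin

lemma cycle_square_edges:
  assumes "edges (square C) \<subseteq> edges G" "e \<in> set (cycle_square (length vs))"
  shows "e \<subseteq> {..<length vs} \<and> (!) vs ` e \<in> edges G"
proof -
  let ?n = "length vs"
  have pos: "0 < ?n" using len by linarith
  have step: "{vs ! i, vs ! (Suc i mod ?n)} \<in> edges C" if "i < ?n" for i
    using that by (auto simp: cycle_edges)
  have "{vs ! i, vs ! (Suc (Suc i) mod ?n)} \<in> edges (square C)" if "i < ?n" for i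
  proof (rule two_step_in_square[OF simple_cycle step[OF that]])
    show "{vs ! (Suc i mod ?n), vs ! (Suc (Suc i) mod ?n)} \<in> edges C"
      using step[of "Suc i mod ?n"] pos by (simp add: mod_Suc_eq)
    have "i \<noteq> Suc (Suc i) mod ?n" using that len by (auto simp: mod_Suc)
    then show "vs ! i \<noteq> vs ! (Suc (Suc i) mod ?n)"
      using that dist pos by (simp add: nth_eq_iff_index_eq)
  qed
  then show ?thesis
    using assms edge_in_square[OF simple_cycle step] pos by (auto simp: cycle_square_def)
qed

text \<open>The square is complete, and the signing by distance works: the cycle is positive, its
  diagonals negative. Each pair has two balanced paths of two edges with different middle vertices,
  and a deletion destroys at most one of them.\<close>

lemma two_canceling_5:
  assumes "simple_graph G" "edges (square C) \<subseteq> edges G" "set vs = verts G" "length vs = 5"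
  shows "k_canceling 2 G"
proof (rule two_canceling_certificate[OF assms(1) _ dist assms(3)])
  show "3 \<le> card (verts G)" using distinct_card[OF dist] assms(3,4) by simp
  show "e \<subseteq> {..<length vs} \<and> (!) vs ` e \<in> edges G" if "e \<in> set (cycle_square 5)" for e
    using cycle_square_edges[OF assms(2)] that assms(4) by simp
  show "certificate (length vs) (cycle_square 5) [{0, 1}, {1, 2}, {2, 3}, {3, 4}, {4, 0}]
     [[0, 2, 1], [0, 4, 1], [0, 3, 2], [0, 4, 2], [0, 1, 3], [0, 2, 3], [0, 1, 4], [0, 3, 4],
      [1, 0, 2], [1, 3, 2], [1, 0, 3], [1, 4, 3], [1, 2, 4], [1, 3, 4], [2, 1, 3], [2, 4, 3],
      [2, 0, 4], [2, 1, 4], [3, 0, 4], [3, 2, 4]]"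
    unfolding assms(4) by code_simp
qed (unfold assms(4), code_simp)

text \<open>For \<open>n = 7\<close> the signing by distance fails: after deleting a vertex, its two neighbours are
  joined by a path of 5 edges with no vertex to spare. The signing and paths below come from a
  computer search.\<close>

lemma two_canceling_7:
  assumes "simple_graph G" "edges (square C) \<subseteq> edges G" "set vs = verts G" "length vs = 7"
  shows "k_canceling 2 G"
proof (rule two_canceling_certificate[OF assms(1) _ dist assms(3)])
  show "3 \<le> card (verts G)" using distinct_card[OF dist] assms(3,4) by simp
  show "e \<subseteq> {..<length vs} \<and> (!) vs ` e \<in> edges G" if "e \<in> set (cycle_square 7)" for e
    using cycle_square_edges[OF assms(2)] that assms(4) by simp
  show "certificate (length vs) (cycle_square 7) [{0, 1}, {0, 2}, {1, 3}, {4, 5}, {5, 6}]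
     [[0, 2, 1], [0, 5, 4, 3, 1], [0, 1, 2], [0, 6, 5, 4, 2], [0, 2, 3], [0, 1, 6, 5, 3],
      [0, 2, 4], [0, 5, 4], [0, 6, 5], [0, 1, 2, 4, 5], [0, 1, 6], [0, 5, 6], [1, 3, 2],
      [1, 0, 5, 4, 2], [1, 0, 2, 4, 3], [1, 0, 6, 5, 3], [1, 6, 5, 4, 3], [1, 3, 4],
      [1, 0, 5, 6, 4], [1, 0, 5], [1, 3, 5], [1, 0, 6], [1, 2, 4, 5, 6], [2, 1, 3],
      [2, 0, 5, 4, 3], [2, 0, 1, 6, 4], [2, 0, 5, 6, 4], [2, 1, 3, 5, 4], [2, 0, 5],
      [2, 4, 5], [2, 0, 6], [2, 1, 3, 5, 6], [3, 5, 4], [3, 1, 0, 6, 4], [3, 4, 5],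
      [3, 1, 2, 0, 5], [3, 1, 6], [3, 5, 6], [4, 6, 5], [4, 3, 1, 0, 5], [4, 2, 0, 1, 6],
      [4, 2, 0, 5, 6], [4, 5, 3, 1, 6], [5, 4, 6], [5, 3, 1, 0, 6]]"
    unfolding assms(4) by code_simp
qed (unfold assms(4), code_simp)

text \<open>Deleting a vertex leaves a path on \<open>length vs - 1\<close> vertices, to which
  \<open>zero_path_all\<close> applies if this number is at least 5 and not 6. This leaves lengths 5
  and 7 to the certificates.\<close>

lemma two_canceling_square:
  assumes G: "simple_graph G" "edges (square C) \<subseteq> edges G" "set vs = verts G"
    and n: "5 \<le> length vs"
  shows "k_canceling 2 G"
proof -
  consider "length vs = 5" | "length vs = 7" | "length vs \<ge> 6" "length vs \<noteq> 7"
    using n by linarith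
  then show ?thesis
  proof cases
    case 3
    \<comment> \<open>The signing is fixed from the whole cycle before \<open>w\<close> is chosen,
      as it must serve every deletion.\<close>
    define \<sigma> :: "'a set \<Rightarrow> int" where "\<sigma> e = (if e \<in> edges C then 1 else -1)" for e
    show ?thesis
    proof (rule two_canceling_if_zero_paths[OF G(1), of \<sigma>])
      show "signing G \<sigma>" by (simp add: signing_def \<sigma>_def)
      show "3 \<le> card (verts G)" using distinct_card[OF dist] G(3) n by simp
      fix w u v
      assume w: "w \<in> verts G" and uv: "u \<in> verts G - {w}" "v \<in> verts G - {w}"
      obtain ys where ys: "distinct ys" "set ys = set vs - {w}" "set (path_edges ys) \<subseteq> edges C"
        using deleted_vertex_path w G(3) by metis
      let ?T = "(set ys, set (path_edges ys))"
      have avoid: "x \<in> set ys \<and> y \<in> set ys" if "{x, y} \<in> set (path_edges ys)" for x y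
        using that Union_path_edges_subset[of ys] by auto
      interpret square_signing ?T "del_verts G {w}" \<sigma>
      proof
        show "simple_graph ?T"
          using ys(3) simple_cycle Union_path_edges_subset[of ys]
          by (auto simp: simple_graph_def)
        show "verts ?T \<subseteq> verts (del_verts G {w})"
          using ys(2) G(3) by (auto simp: del_verts_def)
      next
        fix x y assume xy: "{x, y} \<in> edges ?T"
        then show "{x, y} \<in> edges (del_verts G {w}) \<and> \<sigma> {x, y} = 1"
          using ys avoid[of x y] edge_in_square[OF simple_cycle] G(2)
          by (auto simp: del_verts_def \<sigma>_def)
      next
        fix x c y assume xcy: "{x, c} \<in> edges ?T" "{c, y} \<in> edges ?T" "x \<noteq> y"
        then have "{x, c} \<in> edges C" "{c, y} \<in> edges C" using ys(3) by auto
        \<comment> \<open>Having a common neighbour on the remaining path, \<open>x\<close> and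
          \<open>y\<close> form an edge of the square, and it is not an edge of \<open>C\<close>
          since \<open>C\<close> has no triangle.\<close>
        then show "{x, y} \<in> edges (del_verts G {w}) \<and> \<sigma> {x, y} = -1"
          using xcy ys(2) avoid[of x c] avoid[of c y] triangle_free[of x c y]
            two_step_in_square[OF simple_cycle, of x c y] G(2)
          by (auto simp: del_verts_def \<sigma>_def)
      qed
      have card: "card (set ys) = length vs - 1"
        using ys(2) w G(3) distinct_card[OF dist] by simp
      show "zero_path (del_verts G {w}) \<sigma> u v"
      proof (rule zero_path_all)
        show "connected_graph ?T"
          using connected_path_graph[OF ys(1)] card n by fastforce
      qed (use card 3 uv ys(2) G(3) in auto)
    qed
  qed (use two_canceling_5 two_canceling_7 G in blast)+
qed

end

section \<open>Squares of trees and the theorem\<close>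

lemma tree_triangle_free:
  assumes "tree_graph T" "{x, c} \<in> edges T" "{c, y} \<in> edges T" "x \<noteq> y"
  shows "{x, y} \<notin> edges T"
proof
  assume xy: "{x, y} \<in> edges T"
  have T: "simple_graph T" using assms(1) by (simp add: tree_graph_def)
  note edgeD = simple_graph_edgeD[OF T assms(2)] simple_graph_edgeD[OF T assms(3)]
  let ?C = "({x, c, y}, {{y, x}, {x, c}, {c, y}})"
  have "cycle_graph ?C"
    unfolding cycle_graph_def using edgeD assms(4) by (intro exI[of _ "[x, c, y]"]) auto
  moreover have "subgraph ?C T"
    using assms(2,3) xy edgeD by (simp add: subgraph_def insert_commute)
  ultimately show False using assms(1) by (auto simp: tree_graph_def)
qed

text \<open>The signing by distance works unless a path on six vertices spans \<open>T\<close>; that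
  case has its own certificate.\<close>

lemma canceling_tree_square:
  assumes G: "simple_graph G" "5 \<le> card (verts G)" and T: "tree_graph T"
    and verts: "verts T = verts G" and sub: "edges (square T) \<subseteq> edges G"
  shows "canceling G"
proof -
  have simple: "simple_graph T" and conn: "connected_graph T"
    using T by (auto simp: tree_graph_def)
  show ?thesis
  proof (cases "\<exists>u v p. p \<in> paths T u v \<and> length p = 6 \<and> card (verts T) = 6")
    case True
    then obtain u v p where p: "p \<in> paths T u v" "length p = 6" "card (verts T) = 6"
      by blast
    have "set p \<subseteq> verts T" "card (set p) = 6"
      using p(1,2) distinct_card[of p] by (auto simp: paths_def)
    then have "set p = verts G"
      using p(3) simple by (metis card_subset_eq simple_graph_def verts)
    then show ?thesis using canceling_path6_square[OF G(1) simple sub p(1,2)] by simp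
  next
    case False
    define \<sigma> :: "'a set \<Rightarrow> int" where "\<sigma> e = (if e \<in> edges T then 1 else -1)" for e
    interpret square_signing T G \<sigma>
      using simple verts sub edge_in_square[OF simple] two_step_in_square[OF simple]
        tree_triangle_free[OF T]
      by unfold_locales (auto simp: \<sigma>_def)
    show ?thesis
    proof (rule canceling_if_zero_paths[OF G(1), of \<sigma>])
      show "signing G \<sigma>" by (simp add: signing_def \<sigma>_def)
    qed (rule zero_path_all[OF conn], use False G(2) verts in auto)
  qed
qed

theorem theorem1p3:
  fixes G :: "'a ugraph" and n :: nat
  assumes "simple_graph G" and "card (verts G) = n" and "n \<ge> 5"
  shows "((\<exists>T. tree_graph T \<and> card (verts T) = n \<and> subgraph (square T) G) \<longrightarrow> canceling G) \<and>
    ((\<exists>C. cycle_graph C \<and> verts C = verts G \<and> subgraph (square C) G) \<longrightarrow> k_canceling 2 G)"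
proof (intro conjI impI; elim exE conjE)
  fix T assume T: "tree_graph T" "card (verts T) = n" "subgraph (square T) G"
  \<comment> \<open>The square of \<open>T\<close> has the vertices of \<open>T\<close>, which lie
    in the finite vertex set of \<open>G\<close> and are equally many.\<close>
  then have "verts T = verts G"
    using assms(1,2) card_subset_eq[of "verts G" "verts T"]
    by (simp add: simple_graph_def square_def subgraph_def)
  then show "canceling G"
    using canceling_tree_square[OF assms(1) _ T(1)] T(3) assms(2,3) by (simp add: subgraph_def)
next
  fix C assume C: "cycle_graph C" "verts C = verts G" "subgraph (square C) G"
  then obtain vs where vs: "distinct vs"
    "C = (set vs, insert {last vs, hd vs} (set (path_edges vs)))"
    by (auto simp: cycle_graph_def)
  then have "length vs = n" using C(2) assms(2) distinct_card[of vs] by simp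
  then interpret cycle_list vs C
    using vs assms(3) by unfold_locales auto
  show "k_canceling 2 G"
    using two_canceling_square[of G] assms C(2,3) vs(2) \<open>length vs = n\<close>
    by (simp add: subgraph_def)
qed

end
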